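(* Let $k \geq 3$ be an odd integer. Every connected $(k,2)$-bipartite graph is antimagic.
   Context: All graphs are finite, simple and undirected. A bipartite graph $G=(X\cup Y,E)$ is a $(k,k')$-bipartite graph (biregular bipartite graph) if every vertex of $X$ has degree $k$ and every vertex of $Y$ has degree $k'$. For a graph $G=(V,E)$ with $m=|E|$, an antimagic labelling is a bijection $f:E\to\{1,2,\ldots,m\}$ such that the vertex sums $\sigma(u)=\sum_{v: uv\in E} f(uv)$, $u\in V$, are pairwise distinct. A graph is antimagic if it admits an antimagic labelling. *)

theory Defs
  imports Main
begin

text \<open>
  A graph is given by its vertex set V and its edge set E, where an edge is the two-element set
  of its end vertices; hence there are no loops and no parallel edges.
\<close>

definition simple_graph :: "'a set \<Rightarrow> 'a set set \<Rightarrow> bool" where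
  "simple_graph V E \<longleftrightarrow> finite V \<and> (\<forall>e\<in>E. e \<subseteq> V \<and> card e = 2)"

definition graph_degree :: "'a set set \<Rightarrow> 'a \<Rightarrow> nat" where
  "graph_degree E v = card {e \<in> E. v \<in> e}"

text \<open>The graph without vertices does not count as connected.\<close>

definition connected_graph :: "'a set \<Rightarrow> 'a set set \<Rightarrow> bool" where
  "connected_graph V E \<longleftrightarrow> V \<noteq> {} \<and> (\<forall>u\<in>V. \<forall>v\<in>V. (u, v) \<in> {(a, b). {a, b} \<in> E}\<^sup>*)"

definition bipartite_graph :: "'a set \<Rightarrow> 'a set \<Rightarrow> 'a set set \<Rightarrow> bool" where
  "bipartite_graph X Y E \<longleftrightarrow>
     simple_graph (X \<union> Y) E \<and> X \<inter> Y = {} \<and> (\<forall>e\<in>E. \<exists>x\<in>X. \<exists>y\<in>Y. e = {x, y})"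

definition biregular_bipartite_graph ::
    "nat \<Rightarrow> nat \<Rightarrow> 'a set \<Rightarrow> 'a set \<Rightarrow> 'a set set \<Rightarrow> bool" where
  "biregular_bipartite_graph k k' X Y E \<longleftrightarrow>
     bipartite_graph X Y E \<and>
     (\<forall>x\<in>X. graph_degree E x = k) \<and> (\<forall>y\<in>Y. graph_degree E y = k')"

definition vertex_sum :: "'a set set \<Rightarrow> ('a set \<Rightarrow> nat) \<Rightarrow> 'a \<Rightarrow> nat" where
  "vertex_sum E f u = (\<Sum>v | {u, v} \<in> E. f {u, v})"

definition antimagic_labelling :: "'a set \<Rightarrow> 'a set set \<Rightarrow> ('a set \<Rightarrow> nat) \<Rightarrow> bool" where
  "antimagic_labelling V E f \<longleftrightarrow> bij_betw f E {1..card E} \<and> inj_on (vertex_sum E f) V"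

definition antimagic :: "'a set \<Rightarrow> 'a set set \<Rightarrow> bool" where
  "antimagic V E \<longleftrightarrow> (\<exists>f. antimagic_labelling V E f)"

end

theory Submission
  imports Defs "HOL-Library.Multiset"
begin

text \<open>
  View $Y$ as the edge set of a $k$-regular multigraph on $X$, with $|X| = 2g$, and the edges of $G$
  as its half-edges. Choose for every $x \in X$ an incident representative in $Y$, all distinct, and
  consider decompositions of the multigraph into trails in which every $x$ is an end of a trail
  through its representative. In a decomposition with the fewest trails every $x$ is an end exactly
  once, and no trail consists of one edge only, since it would represent both of its ends. The
  other $k - 1$ half-edges at $x$ are paired by the trails that pass through $x$. If every such pair
  has the same label sum $c$, then $\sigma(x) = c (k-1)/2 + f(e)$ for the half-edge $e$ at which a
  trail ends in $x$, so the sums on $X$ are distinct.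

  The pairs receive the labels $c/2 \pm t$ with $t$ increasing along the trails, and the signs
  alternate along every trail. Then the sums of inner edges of the trails are
  $c \pm 2i$ with distinct $i$, hence odd, whereas the smallest and largest labels can be
  distributed to the ends of the trails so that the sums of the first and last edges are even and
  distinct. A sum on $X$ could only meet a sum on $Y$ if $k = 3$, and this is avoided by arranging
  the trails by increasing length.
\<close>

section \<open>Distinct representatives\<close>

text \<open>A greedy choice works, because giving \<open>y\<close> to one vertex takes it away from
  at most one other vertex. The induction therefore allows a single vertex \<open>w\<close> that has
  lost a candidate, serves it first, and hands its role on to the vertex \<open>w'\<close> that
  loses \<open>y\<close>.\<close>

lemma injective_choice:
  assumes "finite X" "\<forall>y. card {x \<in> X. y \<in> N x} \<le> 2"
    and "\<forall>x\<in>X. x \<noteq> w \<longrightarrow> 2 \<le> card (N x)" "w \<in> X \<Longrightarrow> 1 \<le> card (N w)"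
  shows "\<exists>\<phi>. inj_on \<phi> X \<and> (\<forall>x\<in>X. \<phi> x \<in> N x)"
  using assms
proof (induction "card X" arbitrary: X N w)
  case 0
  thus ?case by simp
next
  case (Suc n)
  define v where "v = (if w \<in> X then w else (SOME x. x \<in> X))"
  have "X \<noteq> {}" using Suc by auto
  hence v: "v \<in> X" by (auto simp: v_def some_in_eq)
  have "1 \<le> card (N v)" using Suc.prems(3,4) v by (cases "v = w") fastforce+
  then obtain y where y: "y \<in> N v" by fastforce
  have cX: "n = card (X - {v})" "finite (X - {v})" using Suc.hyps(2) Suc.prems(1) v by auto
  have two: "\<forall>y'. card {x \<in> X - {v}. y' \<in> N x - {y}} \<le> 2"
  proof
    fix y'
    have "card {x \<in> X - {v}. y' \<in> N x - {y}} \<le> card {x \<in> X. y' \<in> N x}"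
      using Suc.prems(1) by (intro card_mono) auto
    thus "card {x \<in> X - {v}. y' \<in> N x - {y}} \<le> 2" using Suc.prems(2) le_trans by blast
  qed
  have deg: "2 \<le> card (N x)" if "x \<in> X - {v}" for x
    using that Suc.prems(3) by (auto simp: v_def split: if_splits)
  \<comment> \<open>If no remaining vertex has \<open>y\<close> as a candidate, the claim is vacuous
    and any \<open>w'\<close> will do.\<close>
  obtain w' where w': "\<And>x. x \<in> X - {v} \<Longrightarrow> y \<in> N x \<Longrightarrow> x = w'"
  proof (cases "\<exists>x\<in>X - {v}. y \<in> N x")
    case True
    then obtain w' where w': "w' \<in> X - {v}" "y \<in> N w'" by blast
    have "x = w'" if "x \<in> X - {v}" "y \<in> N x" for x
    proof (rule ccontr)
      assume "x \<noteq> w'"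
      hence "card {v, w', x} = 3" using that w' by auto
      moreover have "card {v, w', x} \<le> card {x \<in> X. y \<in> N x}"
        using that w' v y Suc.prems(1) by (intro card_mono) auto
      ultimately show False using Suc.prems(2)[rule_format, of y] by linarith
    qed
    thus ?thesis using that by blast
  qed blast
  have "\<forall>x\<in>X - {v}. x \<noteq> w' \<longrightarrow> 2 \<le> card (N x - {y})"
    using w' deg by (metis Diff_empty Diff_insert0)
  moreover have "1 \<le> card (N w' - {y})" if "w' \<in> X - {v}"
    using deg[OF that] by (cases "y \<in> N w'") (auto simp: card_Diff_singleton_if)
  ultimately obtain \<phi> where \<phi>: "inj_on \<phi> (X - {v})" "\<forall>x\<in>X - {v}. \<phi> x \<in> N x - {y}"
    using Suc.hyps(1)[OF cX(1) cX(2) two] by blast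
  have "inj_on (\<phi>(v := y)) X"
    using \<phi> by (auto simp: inj_on_def split: if_splits)
  thus ?case using \<phi> y by (intro exI[of _ "\<phi>(v := y)"]) auto
qed

lemma two_members:
  assumes "s \<in># T" "t \<in># T" "s \<noteq> t"
  shows "\<exists>R. T = add_mset s (add_mset t R)"
  using assms by (metis insert_noteq_member multi_member_split)

subsection \<open>Decomposition into trails\<close>

text \<open>The middle component keeps parallel edges of the multigraph apart; the order of the
  outer two records the direction in which a trail runs through the edge.\<close>

type_synonym ('x, 'y) arc = "'x \<times> 'y \<times> 'x"

abbreviation src :: "('x, 'y) arc \<Rightarrow> 'x" where "src a \<equiv> fst a"
abbreviation mid :: "('x, 'y) arc \<Rightarrow> 'y" where "mid a \<equiv> fst (snd a)"
abbreviation tgt :: "('x, 'y) arc \<Rightarrow> 'x" where "tgt a \<equiv> snd (snd a)"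

definition flip :: "('x, 'y) arc \<Rightarrow> ('x, 'y) arc" where "flip a = (tgt a, mid a, src a)"

lemma flip_simps [simp]: "src (flip a) = tgt a" "mid (flip a) = mid a" "tgt (flip a) = src a"
  by (simp_all add: flip_def)

definition mids :: "('x, 'y) arc list \<Rightarrow> 'y multiset" where "mids t = mset (map mid t)"

text \<open>A vertex is paired with the element of $Y$ through which the trail ends there, because
  representatives refer to such pairs.\<close>

definition ends :: "('x, 'y) arc list \<Rightarrow> ('x \<times> 'y) set" where
  "ends t = {(src (hd t), mid (hd t)), (tgt (last t), mid (last t))}"

definition end_count :: "'x \<Rightarrow> ('x, 'y) arc list \<Rightarrow> nat" where
  "end_count x t = of_bool (src (hd t) = x) + of_bool (tgt (last t) = x)"

lemma end_count_pos: "0 < end_count x t \<longleftrightarrow> (\<exists>y. (x, y) \<in> ends t)"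
  by (auto simp: end_count_def ends_def)

lemma ends_mids: "t \<noteq> [] \<Longrightarrow> (x, y) \<in> ends t \<Longrightarrow> y \<in># mids t"
  by (auto simp: ends_def mids_def)

definition rev_trail :: "('x, 'y) arc list \<Rightarrow> ('x, 'y) arc list" where
  "rev_trail t = rev (map flip t)"

locale incidence =
  fixes X :: "'x set" and Y :: "'y set" and I :: "'x \<Rightarrow> 'y \<Rightarrow> bool"
  assumes finX: "finite X" and finY: "finite Y"
    and two_ends: "y \<in> Y \<Longrightarrow> \<exists>u v. u \<noteq> v \<and> {x \<in> X. I x y} = {u, v}"
begin

definition arc :: "('x, 'y) arc \<Rightarrow> bool" where
  "arc a \<longleftrightarrow> mid a \<in> Y \<and> src a \<noteq> tgt a \<and> {x \<in> X. I x (mid a)} = {src a, tgt a}"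

text \<open>By itself this is only a walk; that no edge is repeated comes from the multiset equation
  in \<open>trail_system\<close>.\<close>

definition trail :: "('x, 'y) arc list \<Rightarrow> bool" where
  "trail t \<longleftrightarrow> t \<noteq> [] \<and> (\<forall>a\<in>set t. arc a) \<and> successively (\<lambda>a b. tgt a = src b) t"

lemma arc_flip: "arc a \<Longrightarrow> arc (flip a)"
  by (auto simp: arc_def)

lemma trail_nonempty: "trail t \<Longrightarrow> t \<noteq> []" by (simp add: trail_def)

lemma rev_trail:
  assumes "trail t"
  shows "trail (rev_trail t)" "mids (rev_trail t) = mids t" "ends (rev_trail t) = ends t"
    "src (hd (rev_trail t)) = tgt (last t)" "mid (hd (rev_trail t)) = mid (last t)"
    "tgt (last (rev_trail t)) = src (hd t)" "mid (last (rev_trail t)) = mid (hd t)"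
proof -
  have ne: "t \<noteq> []" using assms by (simp add: trail_def)
  show *: "src (hd (rev_trail t)) = tgt (last t)" "mid (hd (rev_trail t)) = mid (last t)"
    "tgt (last (rev_trail t)) = src (hd t)" "mid (last (rev_trail t)) = mid (hd t)"
    using ne by (simp_all add: rev_trail_def hd_rev last_rev last_map hd_map)
  show "ends (rev_trail t) = ends t" by (auto simp: ends_def *)
  show "mids (rev_trail t) = mids t" by (simp add: mids_def rev_trail_def comp_def flip: rev_map)
  show "trail (rev_trail t)" using assms
    by (auto simp: trail_def rev_trail_def successively_map arc_flip elim: successively_mono)
qed

lemma trail_append:
  assumes "trail s" "trail t" "tgt (last s) = src (hd t)"
  shows "trail (s @ t)" "mids (s @ t) = mids s + mids t"
    "ends (s @ t) = {(src (hd s), mid (hd s)), (tgt (last t), mid (last t))}"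
  using assms by (auto simp: trail_def successively_append_iff mids_def ends_def)

lemma orient_trail:
  assumes "trail t" "(x, y) \<in> ends t"
  obtains t' where "trail t'" "mids t' = mids t" "ends t' = ends t"
    "src (hd t') = x" "mid (hd t') = y"
  using assms rev_trail[OF assms(1)] that[of t] that[of "rev_trail t"]
  by (auto simp: ends_def)

text \<open>Reversing \<open>s\<close> makes it arrive at \<open>x\<close>, from where
  \<open>t\<close> departs. This uses up one end of each trail, both at \<open>x\<close>. If
  \<open>s\<close> has both ends at \<open>x\<close>, its other end survives and can supply a new
  representative of \<open>x\<close>.\<close>

lemma merge_trails:
  assumes "trail s" "trail t" "(x, y) \<in> ends s" "(x, z) \<in> ends t"
  shows "\<exists>m. trail m \<and> mids m = mids s + mids t \<and> {p \<in> ends s \<union> ends t. fst p \<noteq> x} \<subseteq> ends m \<and>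
    (end_count x s = 2 \<longrightarrow> (\<exists>y'. (x, y') \<in> ends s \<inter> ends m))"
proof -
  obtain s' where s': "trail s'" "mids s' = mids s" "ends s' = ends s"
    "src (hd s') = x" "mid (hd s') = y" using orient_trail[OF assms(1,3)] by blast
  obtain t' where t': "trail t'" "mids t' = mids t" "ends t' = ends t"
    "src (hd t') = x" "mid (hd t') = z" using orient_trail[OF assms(2,4)] by blast
  note r = rev_trail[OF s'(1)]
  note a = trail_append[OF r(1) t'(1)]
  have eq: "tgt (last (rev_trail s')) = src (hd t')" using r t' s' by simp
  show ?thesis
  proof (intro exI[of _ "rev_trail s' @ t'"] conjI impI)
    show "trail (rev_trail s' @ t')" using a eq by simp
    show "mids (rev_trail s' @ t') = mids s + mids t" using a eq r s' t' by simp
    show "{p \<in> ends s \<union> ends t. fst p \<noteq> x} \<subseteq> ends (rev_trail s' @ t')"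
      using a(3)[OF eq] r s' t' unfolding s'(3)[symmetric] t'(3)[symmetric]
      by (auto simp: ends_def)
    assume "end_count x s = 2"
    hence "src (hd s) = x" "tgt (last s) = x" by (auto simp: end_count_def of_bool_def split: if_splits)
    hence "fst ` ends s' = {x}" using s' by (auto simp: ends_def)
    hence "tgt (last s') = x" by (auto simp: ends_def)
    thus "\<exists>y'. (x, y') \<in> ends s \<inter> ends (rev_trail s' @ t')"
      using r(4,5) unfolding a(3)[OF eq] s'(3)[symmetric]
      by (intro exI[of _ "mid (last s')"]) (simp add: ends_def)
  qed
qed

text \<open>Wherever the walk passes through \<open>x\<close>, the target of one arc and the source
  of the next are both \<open>x\<close>, so only the two ends of the walk affect the parity.\<close>

lemma even_end_count:
  assumes "successively (\<lambda>a b. tgt a = src b) t" "t \<noteq> []"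
  shows "even ((\<Sum>a\<leftarrow>t. of_bool (src a = x) + of_bool (tgt a = x)) + end_count x t)"
  using assms
proof (induction t rule: induct_list012)
  case (3 a b t)
  thus ?case by (auto simp: end_count_def split: if_splits)
qed (auto simp: end_count_def)

section \<open>Systems of trails with as few trails as possible\<close>

definition trail_system :: "('x, 'y) arc list multiset \<Rightarrow> bool" where
  "trail_system T \<longleftrightarrow> (\<forall>t\<in>#T. trail t) \<and> (\<Sum>t\<in>#T. mids t) = mset_set Y"

definition represented :: "('x, 'y) arc list multiset \<Rightarrow> ('x \<Rightarrow> 'y) \<Rightarrow> bool" where
  "represented T \<phi> \<longleftrightarrow> inj_on \<phi> X \<and> (\<forall>x\<in>X. \<exists>t\<in>#T. (x, \<phi> x) \<in> ends t)"

lemma system_unique: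
  assumes "trail_system T" "t \<in># T" "s \<in># T" "y \<in># mids t" "y \<in># mids s"
  shows "s = t"
proof (rule ccontr)
  assume "s \<noteq> t"
  then obtain R where "T = add_mset t (add_mset s R)" using assms(2,3)
    using two_members by metis
  hence "mids t + mids s \<subseteq># mset_set Y"
    using assms(1)
    by (auto simp: trail_system_def simp flip: add.assoc) (metis mset_subset_eq_add_left)
  hence "count (mids t) y + count (mids s) y \<le> count (mset_set Y) y"
    using mset_subset_eq_count by fastforce
  moreover have "count (mset_set Y) y \<le> 1" by (cases "y \<in> Y"; cases "finite Y") auto
  moreover have "count (mids t) y \<ge> 1" "count (mids s) y \<ge> 1" using assms by simp_all
  ultimately show False by linarith
qed

lemma degree_sum:
  assumes "trail_system T" "x \<in> X"
  shows "(\<Sum>t\<in>#T. \<Sum>a\<leftarrow>t. of_bool (src a = x) + of_bool (tgt a = x)) = card {y \<in> Y. I x y}"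
proof -
  define f where "f y = (of_bool (I x y) :: nat)" for y
  have "of_bool (src a = x) + of_bool (tgt a = x) = f (mid a)" if "arc a" for a
  proof -
    have "I x (mid a) \<longleftrightarrow> x = src a \<or> x = tgt a"
      using that assms(2) unfolding arc_def by blast
    thus ?thesis using that unfolding arc_def f_def by auto
  qed
  hence "(\<Sum>a\<leftarrow>t. of_bool (src a = x) + of_bool (tgt a = x)) = (\<Sum>y\<in>#mids t. f y)" if "t \<in># T" for t
    using that assms(1) unfolding trail_system_def trail_def mids_def
    by (auto simp: comp_def sum_mset_sum_list intro!: arg_cong[of _ _ sum_list] map_cong simp flip: mset_map)
  hence "(\<Sum>t\<in>#T. \<Sum>a\<leftarrow>t. of_bool (src a = x) + of_bool (tgt a = x)) = (\<Sum>t\<in>#T. \<Sum>y\<in>#mids t. f y)"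
    by (intro arg_cong[of _ _ sum_mset] image_mset_cong) auto
  also have "\<dots> = (\<Sum>y\<in>#(\<Sum>t\<in>#T. mids t). f y)" by (induction T) auto
  also have "\<dots> = (\<Sum>y\<in>Y. f y)" using assms by (simp add: trail_system_def sum_unfold_sum_mset)
  also have "\<dots> = card {y \<in> Y. I x y}" using finY by (simp add: f_def sum.If_cases Int_def of_bool_def)
  finally show ?thesis .
qed

text \<open>The half-edges at \<open>x\<close> on all trails add up to the degree, so adding
  \<open>even_end_count\<close> over the trails transfers the parity of the degree to the
  ends.\<close>

lemma odd_ends:
  assumes "trail_system T" "x \<in> X" "odd (card {y \<in> Y. I x y})"
  shows "odd (\<Sum>t\<in>#T. end_count x t)"
proof -
  have "even ((\<Sum>t\<in>#T. \<Sum>a\<leftarrow>t. of_bool (src a = x) + of_bool (tgt a = x)) + (\<Sum>t\<in>#T. end_count x t))"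
    if "\<forall>t\<in>#T. trail t" using that
  proof (induction T)
    case (add t T)
    thus ?case using even_end_count[of t x] by (auto simp: trail_def)
  qed simp
  thus ?thesis using degree_sum[OF assms(1,2)] assms by (simp add: trail_system_def)
qed

text \<open>If every element of $Y$ is a trail of its own, \<open>x\<close> is an end through each
  element incident with it; only the distinctness of the representatives takes an argument.\<close>

lemma initial_system:
  assumes "\<And>x. x \<in> X \<Longrightarrow> 2 \<le> card {y \<in> Y. I x y}"
  shows "\<exists>T \<phi>. trail_system T \<and> represented T \<phi>"
proof -
  obtain u v where uv: "\<And>y. y \<in> Y \<Longrightarrow> u y \<noteq> v y \<and> {x \<in> X. I x y} = {u y, v y}"
  proof -
    have "\<forall>y\<in>Y. \<exists>p. fst p \<noteq> snd p \<and> {x \<in> X. I x y} = {fst p, snd p}"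
      using two_ends by simp
    then obtain p where "\<forall>y\<in>Y. fst (p y) \<noteq> snd (p y) \<and> {x \<in> X. I x y} = {fst (p y), snd (p y)}"
      using bchoice[of Y "\<lambda>y p. fst p \<noteq> snd p \<and> {x \<in> X. I x y} = {fst p, snd p}"] by blast
    thus ?thesis using that[of "fst \<circ> p" "snd \<circ> p"] by simp
  qed
  define h where "h = (\<lambda>y. [(u y, y, v y)])"
  have "\<forall>y. card {x \<in> X. y \<in> {y \<in> Y. I x y}} \<le> 2"
  proof
    fix y show "card {x \<in> X. y \<in> {y \<in> Y. I x y}} \<le> 2"
      using uv[of y] by (cases "y \<in> Y") auto
  qed
  \<comment> \<open>No vertex has fewer than two candidates, so any value may stand for the
    exceptional vertex.\<close>
  then obtain \<phi> where \<phi>: "inj_on \<phi> X" "\<forall>x\<in>X. \<phi> x \<in> {y \<in> Y. I x y}"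
    using injective_choice[of X "\<lambda>x. {y \<in> Y. I x y}" undefined, OF finX] assms[THEN order_trans[OF one_le_numeral]] assms
    by blast
  have "(\<Sum>t\<in>#image_mset h (mset_set Y). mids t) = mset_set Y"
    by (simp add: h_def mids_def comp_def image_mset.compositionality)
  moreover have "\<forall>t\<in>#image_mset h (mset_set Y). trail t"
    using uv finY by (auto simp: h_def trail_def arc_def)
  moreover have "(x, \<phi> x) \<in> ends (h (\<phi> x))" if "x \<in> X" for x
    using \<phi>(2) uv[of "\<phi> x"] that by (auto simp: h_def ends_def)
  ultimately have "trail_system (image_mset h (mset_set Y)) \<and> represented (image_mset h (mset_set Y)) \<phi>"
    using \<phi> finY by (auto simp: trail_system_def represented_def)
  thus ?thesis by blast
qed

text \<open>The representatives of other vertices belong to ends away from \<open>x\<close> and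
  survive the merger; only that of \<open>x\<close> may have to change.\<close>

lemma represented_merge:
  assumes T: "T = add_mset s (add_mset t R)" "represented T \<phi>" "trail_system T"
    and m: "mids m = mids s + mids t" "trail m"
      "{p \<in> ends s \<union> ends t. fst p \<noteq> x} \<subseteq> ends m"
    and x: "x \<in> X" "\<exists>t\<in>#add_mset m R. (x, y) \<in> ends t" "\<And>z. z \<in> X \<Longrightarrow> z \<noteq> x \<Longrightarrow> \<phi> z \<noteq> y"
  shows "trail_system (add_mset m R) \<and> represented (add_mset m R) (\<phi>(x := y))"
proof -
  have "\<exists>t\<in>#add_mset m R. (z, \<phi> z) \<in> ends t" if "z \<in> X" "z \<noteq> x" for z
    using T(1,2) m(3) that by (auto simp: represented_def)
  moreover have "inj_on (\<phi>(x := y)) X"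
    using T(2) x by (auto simp: represented_def inj_on_def)
  moreover have "\<exists>t\<in>#add_mset m R. (z, (\<phi>(x := y)) z) \<in> ends t" if "z \<in> X" for z
    using x(2) calculation(1)[OF that] by (cases "z = x") auto
  moreover have "trail_system (add_mset m R)"
    using T(3) m(1,2) unfolding T(1) trail_system_def by (simp add: add.assoc)
  ultimately show ?thesis unfolding represented_def by blast
qed

lemma odd_ge_3: "odd n \<Longrightarrow> n \<noteq> 1 \<Longrightarrow> 3 \<le> n" for n :: nat
  by presburger

text \<open>
  If $x$ were the end of three trails, two trails could be merged at $x$. When one of them is
  closed, an end of it becomes the new representative of $x$: the trail through that element of
  $Y$ ends only at $x$, so no other vertex is represented by it. Otherwise two trails can be chosen
  that do not carry the representative of $x$.
\<close>

lemma minimal_system: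
  assumes "trail_system T" "represented T \<phi>"
    and min: "\<And>T' \<phi>'. trail_system T' \<Longrightarrow> represented T' \<phi>' \<Longrightarrow> size T \<le> size T'"
    and x: "x \<in> X" "odd (card {y \<in> Y. I x y})"
  shows "(\<Sum>t\<in>#T. end_count x t) = 1"
proof (rule ccontr)
  assume "(\<Sum>t\<in>#T. end_count x t) \<noteq> 1"
  hence three: "(\<Sum>t\<in>#T. end_count x t) \<ge> 3"
    using odd_ends[OF assms(1) x] odd_ge_3 by blast
  have pick: "\<exists>t R'. R = add_mset t R' \<and> (\<exists>y. (x, y) \<in> ends t)" if "0 < (\<Sum>t\<in>#R. end_count x t)" for R
  proof -
    have "\<exists>t\<in>#R. 0 < end_count x t" using that by (induction R) auto
    thus ?thesis using end_count_pos by (metis multi_member_split)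
  qed
  have le2: "end_count x t \<le> 2" for t :: "('x, 'y) arc list" by (simp add: end_count_def)
  have no_merge: False if T: "T = add_mset s (add_mset t R)" and m: "mids m = mids s + mids t" "trail m"
      "{p \<in> ends s \<union> ends t. fst p \<noteq> x} \<subseteq> ends m"
    and y: "\<exists>t\<in>#add_mset m R. (x, y) \<in> ends t" "\<And>z. z \<in> X \<Longrightarrow> z \<noteq> x \<Longrightarrow> \<phi> z \<noteq> y" for s t R m y
    using represented_merge[OF T assms(2,1) m x(1) y] min[of "add_mset m R" "\<phi>(x := y)"] T by simp
  have rep: "\<forall>x\<in>X. \<exists>t\<in>#T. (x, \<phi> x) \<in> ends t" using assms(2) by (simp add: represented_def)
  have tr: "\<And>t. t \<in># T \<Longrightarrow> trail t" using assms(1) by (simp add: trail_system_def)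
  show False
  proof (cases "\<exists>s\<in>#T. end_count x s = 2")
    case True
    then obtain s R where s: "T = add_mset s R" "end_count x s = 2" by (metis multi_member_split)
    then obtain t R' y z where t: "R = add_mset t R'" "(x, z) \<in> ends t" "(x, y) \<in> ends s"
      using three pick[of R] end_count_pos[of x s] by auto
    obtain m where m: "trail m" "mids m = mids s + mids t"
      "{p \<in> ends s \<union> ends t. fst p \<noteq> x} \<subseteq> ends m"
      "\<exists>y'. (x, y') \<in> ends s \<inter> ends m"
      using merge_trails[OF _ _ t(3,2)] tr s t by auto
    then obtain y' where y': "(x, y') \<in> ends s" "(x, y') \<in> ends m" by blast
    have "\<phi> w \<noteq> y'" if w: "w \<in> X" "w \<noteq> x" for w
    proof
      assume eq: "\<phi> w = y'"
      obtain s' where s': "s' \<in># T" "(w, y') \<in> ends s'"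
        using bspec[OF rep w(1)] unfolding eq by (rule bexE)
      have sT: "s \<in># T" using s by simp
      have "y' \<in># mids s" by (rule ends_mids[OF trail_nonempty[OF tr[OF sT]] y'(1)])
      moreover have "y' \<in># mids s'" by (rule ends_mids[OF trail_nonempty[OF tr[OF s'(1)]] s'(2)])
      ultimately have "s' = s" using system_unique[OF assms(1) sT s'(1)] by blast
      hence "(w, y') \<in> ends s" using s' by simp
      hence "w = x" using s(2) by (auto simp: ends_def end_count_def of_bool_def split: if_splits)
      thus False using w by simp
    qed
    thus False using no_merge[of s t R' m y'] s t m y' by auto
  next
    case False
    hence le1: "\<And>t. t \<in># T \<Longrightarrow> end_count x t \<le> 1" using le2 by (metis le_Suc_eq numeral_2_eq_2 One_nat_def)
    obtain d R where d: "T = add_mset d R" "(x, \<phi> x) \<in> ends d"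
      using bspec[OF rep x(1)] by (blast dest: multi_member_split)
    have "(\<Sum>t\<in>#R. end_count x t) \<ge> 2" using three le1[of d] d by simp
    then obtain s R1 y where s: "R = add_mset s R1" "(x, y) \<in> ends s" using pick[of R] by auto
    have "(\<Sum>t\<in>#R1. end_count x t) \<ge> 1" using three le1[of d] le1[of s] d s by simp
    then obtain t R2 z where t: "R1 = add_mset t R2" "(x, z) \<in> ends t" using pick[of R1] by auto
    have "trail s" "trail t" using tr d s t by auto
    then obtain m where m: "trail m" "mids m = mids s + mids t"
      "{p \<in> ends s \<union> ends t. fst p \<noteq> x} \<subseteq> ends m"
      using merge_trails[OF _ _ s(2) t(2)] by blast
    \<comment> \<open>The representative of \<open>x\<close> is kept, since \<open>d\<close> takes
      no part in the merger.\<close>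
    have "\<phi> w \<noteq> \<phi> x" if "w \<in> X" "w \<noteq> x" for w
      using assms(2) that x(1) by (auto simp: represented_def inj_on_def)
    thus False using no_merge[of s t "add_mset d R2" m "\<phi> x", OF _ m(2,1,3)] d s t
      by (auto simp: add_mset_commute)
  qed
qed

theorem trail_decomposition:
  assumes "\<And>x. x \<in> X \<Longrightarrow> odd (card {y \<in> Y. I x y})" "\<And>x. x \<in> X \<Longrightarrow> 2 \<le> card {y \<in> Y. I x y}"
  shows "\<exists>ts. (\<forall>t\<in>set ts. trail t \<and> 2 \<le> length t) \<and>
    distinct (map mid (concat ts)) \<and> set (map mid (concat ts)) = Y \<and>
    (\<forall>x\<in>X. (\<Sum>t\<leftarrow>ts. end_count x t) = 1) \<and> sorted (map length ts)"
proof -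
  have "\<exists>T. \<exists>\<phi>. trail_system T \<and> represented T \<phi>" using initial_system assms(2) by blast
  then obtain T where "\<exists>\<phi>. trail_system T \<and> represented T \<phi>"
    and min': "\<And>T'. \<exists>\<phi>. trail_system T' \<and> represented T' \<phi> \<Longrightarrow> size T \<le> size T'"
    using ex_has_least_nat[of "\<lambda>T. \<exists>\<phi>. trail_system T \<and> represented T \<phi>" _ size] by blast
  then obtain \<phi> where T: "trail_system T" "represented T \<phi>" by blast
  have min: "size T \<le> size T'" if "trail_system T'" "represented T' \<phi>'" for T' \<phi>'
    using min' that by blast
  have one: "(\<Sum>t\<in>#T. end_count x t) = 1" if "x \<in> X" for x
    using minimal_system[OF T min that assms(1)[OF that]] .
  have only: "t = d" if prem: "x \<in> X" "t \<in># T" "d \<in># T" "(x, y) \<in> ends t" "(x, z) \<in> ends d" for x y z t d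
  proof (rule ccontr)
    assume "t \<noteq> d"
    then obtain R where "T = add_mset t (add_mset d R)" using two_members[OF prem(2,3)] by blast
    moreover have "0 < end_count x t" "0 < end_count x d" using prem(4,5) unfolding end_count_pos by blast+
    ultimately show False using one[OF prem(1)] by simp
  qed
  have len: "2 \<le> length t" if t: "t \<in># T" for t
  proof (rule ccontr)
    assume "\<not> 2 \<le> length t"
    moreover have tr: "trail t" using T t by (simp add: trail_system_def)
    ultimately obtain a where a: "t = [a]" by (cases t; cases "tl t") (auto simp: trail_def)
    have uv: "src a \<in> X" "tgt a \<in> X" "src a \<noteq> tgt a" using tr a by (auto simp: trail_def arc_def)
    \<comment> \<open>No trail but \<open>t\<close> ends at \<open>x\<close>, so the only edge of
      \<open>t\<close> must be the representative of \<open>x\<close>.\<close>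
    have "\<phi> x = mid a" if "x = src a \<or> x = tgt a" for x
    proof -
      have "x \<in> X" "(x, mid a) \<in> ends t" using that uv a by (auto simp: ends_def)
      moreover obtain d where "d \<in># T" "(x, \<phi> x) \<in> ends d"
        using T(2) \<open>x \<in> X\<close> by (auto simp: represented_def)
      ultimately have "(x, \<phi> x) \<in> ends t" using only[OF _ t] by blast
      thus ?thesis using a by (auto simp: ends_def)
    qed
    hence "\<phi> (src a) = \<phi> (tgt a)" by simp
    thus False using uv T(2) by (auto simp: represented_def inj_on_def)
  qed
  obtain us where us: "mset us = T" using ex_mset by blast
  \<comment> \<open>The multiset leaves the order of the trails free; sorting by length will provide
    \<open>l_mono\<close>, on which the case $k = 3$ rests.\<close>
  define ts where "ts = sort_key length us"
  have ts: "mset ts = T" by (simp add: ts_def us)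
  have set: "set ts = set_mset T" using ts by (metis set_mset_mset)
  have mm: "mset (map mid (concat ts)) = mset_set Y"
  proof -
    have "mset (map mid (concat ts)) = (\<Sum>t\<in>#mset ts. mids t)"
      by (induction ts) (auto simp: mids_def)
    thus ?thesis using T ts by (simp add: trail_system_def)
  qed
  show ?thesis
  proof (intro exI[of _ ts] conjI ballI)
    show "trail t" "2 \<le> length t" if "t \<in> set ts" for t
      using that set T len by (auto simp: trail_system_def)
    show Y: "set (map mid (concat ts)) = Y"
      using arg_cong[OF mm, of set_mset] finY by (simp only: set_mset_mset finite_set_mset_mset_set)
    show "distinct (map mid (concat ts))"
      unfolding distinct_count_atmost_1 mm Y using finY by (simp add: count_mset_set')
    show "(\<Sum>t\<leftarrow>ts. end_count x t) = 1" if "x \<in> X" for x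
      using one[OF that] ts by (metis mset_map sum_mset_sum_list)
    show "sorted (map length ts)" by (simp add: ts_def)
  qed
qed

end

subsection \<open>Labels on trails\<close>

text \<open>The labels depend only on the numbers of junctions and are studied apart from the graph.
  Each of the $2g$ vertices of $X$ is passed $K = (k-1)/2$ times, hence
  \<open>l_sum\<close>.\<close>

locale path_labelling =
  fixes l :: "nat \<Rightarrow> nat" and g K :: nat
  assumes l_pos: "j < g \<Longrightarrow> 1 \<le> l j"
    and l_mono: "i \<le> j \<Longrightarrow> j < g \<Longrightarrow> l i \<le> l j"
    and l_sum: "(\<Sum>j<g. l j) = 2 * K * g"
    and K_pos: "1 \<le> K"
begin

text \<open>
  The $g$ trails are numbered by $j$, and \<open>l j\<close> is the number of inner vertices (junctions) of
  trail $j$, so that its arcs are numbered from $0$ to \<open>l j\<close>. The $i$-th junction of trail $j$ has the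
  index \<open>P j + i\<close> among all $M$ junctions; the two half-edges paired there receive \<open>A\<close> plus
  the index and \<open>A + 1\<close> minus the index, the former going to the incoming half-edge iff $i$ is odd.
  The $2g$ half-edges at the ends of the trails receive the \<open>low\<close> smallest and the
  \<open>2 * g - low\<close> largest labels, \<open>lab z\<close> being the $z$-th of them. They are ranked as follows:
  first, in decreasing order of $j$, the last half-edges of the trails with odd \<open>l j\<close>, which
  meet a small label in their last arc; then, in increasing order, all the others, of which
  \<open>U j\<close> lie on trails before $j$. (Since \<open>D j \<le> j\<close>, no subtraction truncates.)
  This makes all sums on first and last arcs even and all other arc sums odd.
\<close>

definition M :: nat where "M = 2 * K * g"
definition P :: "nat \<Rightarrow> nat" where "P j = (\<Sum>i<j. l i)"
definition D :: "nat \<Rightarrow> nat" where "D j = (\<Sum>i<j. l i mod 2)"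
definition U :: "nat \<Rightarrow> nat" where "U j = 2 * j - D j"
definition odd_paths :: nat where "odd_paths = D g"
definition low :: nat where "low = g + g mod 2"
definition A :: nat where "A = M + low"
definition csum :: nat where "csum = 2 * A + 1"
definition lab :: "nat \<Rightarrow> nat" where "lab z = (if z \<le> low then z else z + 2 * M)"

definition src_label :: "nat \<Rightarrow> nat \<Rightarrow> nat" where
  "src_label j i =
     (if i = 0 then lab (odd_paths + 1 + U j)
      else if odd i then A + 1 - (P j + i) else A + (P j + i))"

definition tgt_label :: "nat \<Rightarrow> nat \<Rightarrow> nat" where
  "tgt_label j i =
     (if i < l j then (if even i then A + (P j + i + 1) else A - (P j + i))
      else if even (l j) then lab (odd_paths + 2 + U j) else odd_paths - D j)"

lemma P_Suc: "P (Suc j) = P j + l j" by (simp add: P_def)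
lemma D_Suc: "D (Suc j) = D j + l j mod 2" by (simp add: D_def)
lemma P_g: "P g = M" by (simp add: P_def M_def l_sum)

lemma P_mono: "i \<le> j \<Longrightarrow> P i \<le> P j"
  by (induction rule: dec_induct) (auto simp: P_Suc)
lemma D_mono: "i \<le> j \<Longrightarrow> D i \<le> D j"
  by (induction rule: dec_induct) (auto simp: D_Suc)
lemma D_le: "i \<le> j \<Longrightarrow> D j + i \<le> D i + j"
  by (induction rule: dec_induct) (auto simp: D_Suc)
lemma D_le_self: "D j \<le> j" using D_le[of 0 j] by (simp add: D_def)

text \<open>\<open>P\<close> and \<open>D\<close> add up numbers of equal parity, \<open>l i\<close>
  and \<open>l i mod 2\<close>.\<close>

lemma even_P_D: "even (P j + D j)"
  by (induction j) (auto simp: P_Suc D_Suc P_def D_def)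
lemma even_M: "even M" by (simp add: M_def)
lemma even_odd_paths: "even odd_paths" using even_P_D[of g] even_M by (simp add: P_g odd_paths_def)
text \<open>This is why \<open>low\<close> is $g$ rounded up to an even number: it makes
  \<open>A\<close> even, on which the parity of the arc sums depends.\<close>

lemma even_low: "even low" by (simp add: low_def)
lemma even_lab: "even (lab z) = even z" by (simp add: lab_def)
lemma odd_paths_le: "odd_paths \<le> g" using D_le_self by (simp add: odd_paths_def)
lemma low_bounds: "g \<le> low" "low \<le> g + 1" by (auto simp: low_def)
lemma M_ge: "2 * g \<le> M" using K_pos by (simp add: M_def)
lemma lab_mono: "z < z' \<Longrightarrow> lab z < lab z'" by (simp add: lab_def)
lemma lab_inj: "lab z = lab z' \<longleftrightarrow> z = z'" by (auto simp: lab_def)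

lemma P_step: "j < g \<Longrightarrow> P j + l j \<le> M"
  using P_mono[of "Suc j" g] by (simp add: P_Suc P_g)
lemma P_less: "i < j \<Longrightarrow> P i + l i \<le> P j"
  using P_mono[of "Suc i" j] by (simp add: P_Suc)
lemma D_less: "i < j \<Longrightarrow> D i + l i mod 2 \<le> D j"
  using D_mono[of "Suc i" j] by (simp add: D_Suc)
lemma D_less': "i < j \<Longrightarrow> D j + Suc i \<le> D i + l i mod 2 + j"
  using D_le[of "Suc i" j] by (simp add: D_Suc)

text \<open>Trail \<open>i\<close> takes two of the ranks counted by \<open>U\<close> if
  \<open>l i\<close> is even, but only one if it is odd, its last half-edge then being among the
  first \<open>odd_paths\<close> ranks.\<close>

lemma U_less: "i < j \<Longrightarrow> U i + 2 \<le> U j + l i mod 2"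
  using D_less'[of i j] D_le_self[of i] D_le_self[of j] unfolding U_def by linarith
lemma U_less1: "i < j \<Longrightarrow> U i + 1 \<le> U j"
  using U_less[of i j] by (cases "even (l i)") (auto elim!: oddE evenE)
lemma U_less2: "i < j \<Longrightarrow> even (l i) \<Longrightarrow> U i + 2 \<le> U j"
  using U_less[of i j] by (auto)
lemma U_g: "U g = 2 * g - odd_paths" by (simp add: U_def odd_paths_def)
lemma even_P_U: "even (P j + U j)"
  using even_P_D[of j] D_le_self[of j] by (simp add: U_def)
lemma odd_l_D: "j < g \<Longrightarrow> odd (l j) \<Longrightarrow> D j + 1 \<le> odd_paths"
  using D_less[of j g] by (simp add: odd_paths_def odd_iff_mod_2_eq_one)
lemma D_less1: "i < j \<Longrightarrow> odd (l i) \<Longrightarrow> D i + 1 \<le> D j"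
  using D_less[of i j] by (simp add: odd_iff_mod_2_eq_one)

lemma src_label_0: "src_label j 0 = lab (odd_paths + 1 + U j)"
  by (simp add: src_label_def)
lemma tgt_label_last: "tgt_label j (l j) = (if even (l j) then lab (odd_paths + 2 + U j) else odd_paths - D j)"
  by (simp add: tgt_label_def)

text \<open>With \<open>n = P j + i + 1\<close> the two labels are \<open>A + n\<close> and
  \<open>A + 1 - n\<close> in some order; no subtraction truncates, as \<open>n\<close> \<le>
  \<open>M\<close> \<le> \<open>A\<close>.\<close>

lemma junction_sum:
  assumes "j < g" "i < l j"
  shows "tgt_label j i + src_label j (Suc i) = csum"
  using assms P_step[of j] by (auto simp: src_label_def tgt_label_def csum_def A_def)

lemma special_rank_lab:
  assumes "z \<ge> 1" "z \<le> 2 * g"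
  shows "lab z \<in> {1..low} \<union> {low + 2 * M + 1..2 * M + 2 * g}"
  using assms by (auto simp: lab_def)

lemma U_rank:
  assumes "j < g"
  shows "odd_paths + 1 + U j \<le> 2 * g" "even (l j) \<Longrightarrow> odd_paths + 2 + U j \<le> 2 * g"
  using U_less1[OF assms] U_less2[OF assms] odd_paths_le by (auto simp: U_g)

section \<open>The labels of the half-edges form a bijection\<close>

definition positions :: "(nat \<times> nat \<times> bool) set" where
  "positions = {(j, i, b). j < g \<and> i \<le> l j}"
text \<open>These are the half-edges at the ends of the trails; all others are paired at
  junctions.\<close>

definition special :: "nat \<times> nat \<times> bool \<Rightarrow> bool" where
  "special = (\<lambda>(j, i, b). if b then i = l j else i = 0)"
definition label :: "nat \<times> nat \<times> bool \<Rightarrow> nat" where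
  "label = (\<lambda>(j, i, b). if b then tgt_label j i else src_label j i)"

definition rank :: "nat \<times> nat \<times> bool \<Rightarrow> nat" where
  "rank = (\<lambda>(j, i, b). if \<not> b then odd_paths + 1 + U j else if even (l j) then odd_paths + 2 + U j else odd_paths - D j)"

lemma label_special:
  assumes "p \<in> positions" "special p"
  shows "label p = lab (rank p)" "rank p \<in> {1..2 * g}"
proof -
  obtain j i b where p: "p = (j, i, b)" by (cases p)
  have j: "j < g" using assms p by (simp add: positions_def)
  show "rank p \<in> {1..2 * g}"
    using U_rank[OF j] odd_l_D[OF j] odd_paths_le p by (auto simp: rank_def)
  show "label p = lab (rank p)"
    using assms(2) p low_bounds odd_paths_le
    by (auto simp: special_def label_def rank_def src_label_0 tgt_label_last lab_def)
qed

text \<open>The ranks up to \<open>odd_paths\<close> decrease with \<open>j\<close> through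
  \<open>D\<close>, the larger ones increase with \<open>j\<close> through \<open>U\<close>.\<close>

lemma rank_inj_aux:
  assumes "j \<le> j'" "j < g" "j' < g" "rank (j, i, b) = rank (j', i', b')"
  shows "j = j' \<and> b = b'"
proof (rule ccontr)
  assume neg: "\<not> (j = j' \<and> b = b')"
  have 1: "odd (l j) \<Longrightarrow> D j + 1 \<le> odd_paths" "odd (l j') \<Longrightarrow> D j' + 1 \<le> odd_paths"
    using odd_l_D assms by auto
  consider "j = j'" "b \<noteq> b'" | "j < j'" using neg assms by force
  thus False
  proof cases
    case 1 thus False using assms by (auto simp: rank_def split: if_splits)
  next
    case 2
    show False using U_less1[OF 2] U_less2[OF 2] D_less1[OF 2] 1 assms(4)
      by (auto simp: rank_def split: if_splits)
  qed
qed

lemma rank_inj: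
  assumes "p \<in> positions" "special p" "q \<in> positions" "special q" "rank p = rank q"
  shows "p = q"
proof -
  obtain j i b where p: "p = (j, i, b)" by (cases p)
  obtain j' i' b' where q: "q = (j', i', b')" by (cases q)
  have *: "j < g" "j' < g" using assms p q by (auto simp: positions_def)
  have "j = j' \<and> b = b'"
    using rank_inj_aux[of j j' i b i' b'] rank_inj_aux[of j' j i' b' i b] * assms(5) p q
    by (metis linorder_linear)
  thus ?thesis using assms(2,4) p q by (auto simp: special_def split: if_splits)
qed

text \<open>The target half of an arc lies at the junction after it, its source half at the junction
  before it.\<close>

definition junction_index :: "nat \<times> nat \<times> bool \<Rightarrow> nat" where
  "junction_index = (\<lambda>(j, i, b). if b then P j + i + 1 else P j + i)"
text \<open>An inner half-edge has the larger label of its pair iff the number of its arc is even;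
  this is the alternation of signs along a trail.\<close>

definition upper :: "nat \<times> nat \<times> bool \<Rightarrow> bool" where
  "upper = (\<lambda>(j, i, b). even i)"

lemma label_not_special:
  assumes "p \<in> positions" "\<not> special p"
  shows "label p = (if upper p then A + junction_index p else A + 1 - junction_index p)"
    "junction_index p \<in> {1..M}"
proof -
  obtain j i b where p: "p = (j, i, b)" by (cases p)
  have j: "j < g" "i \<le> l j" using assms p by (auto simp: positions_def)
  show "junction_index p \<in> {1..M}"
    using P_step[OF j(1)] j assms(2) by (auto simp: p junction_index_def special_def split: if_splits)
  show "label p = (if upper p then A + junction_index p else A + 1 - junction_index p)"
    using j assms(2)
    by (auto simp: p junction_index_def special_def upper_def label_def src_label_def tgt_label_def split: if_splits)
qed

lemma index_inj:
  assumes "j < g" "j' < g" "1 \<le> i" "i \<le> l j" "1 \<le> i'" "i' \<le> l j'" "P j + i = P j' + i'"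
  shows "j = j' \<and> i = i'"
proof -
  have "\<not> j < j'" "\<not> j' < j" using P_less[of j j'] P_less[of j' j] assms by auto
  thus ?thesis using assms by auto
qed

lemma junction_index_inj:
  assumes "p \<in> positions" "\<not> special p" "q \<in> positions" "\<not> special q"
    and "junction_index p = junction_index q" "upper p = upper q"
  shows "p = q"
proof -
  obtain j i b where p: "p = (j, i, b)" by (cases p)
  obtain j' i' b' where q: "q = (j', i', b')" by (cases q)
  have "j = j' \<and> i + of_bool b = i' + of_bool b'"
    using assms by (intro index_inj) (auto simp: p q positions_def special_def junction_index_def split: if_splits)
  \<comment> \<open>If \<open>b\<close> and \<open>b'\<close> differed, \<open>i\<close> and
    \<open>i'\<close> would differ by 1 and have different parity.\<close>
  thus ?thesis using assms(6) by (cases b; cases b') (auto simp: p q upper_def)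
qed

lemma finite_positions: "finite positions"
proof -
  have "positions = Sigma {..<g} (\<lambda>j. {..l j} \<times> UNIV)" by (auto simp: positions_def)
  thus ?thesis by simp
qed

lemma card_positions: "card positions = 2 * M + 2 * g"
proof -
  have "positions = Sigma {..<g} (\<lambda>j. {..l j} \<times> UNIV)" by (auto simp: positions_def)
  hence "card positions = (\<Sum>j<g. 2 * l j + 2)" by (simp add: algebra_simps)
  also have "\<dots> = 2 * M + 2 * g"
    unfolding sum.distrib sum_distrib_left[symmetric] l_sum by (simp add: M_def)
  finally show ?thesis .
qed

lemma label_range:
  assumes "p \<in> positions"
  shows "special p \<Longrightarrow> label p \<in> {1..low} \<union> {low + 2 * M + 1..2 * M + 2 * g}"
    "\<not> special p \<Longrightarrow> label p \<in> {low + 1..low + 2 * M}"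
proof -
  show "special p \<Longrightarrow> label p \<in> {1..low} \<union> {low + 2 * M + 1..2 * M + 2 * g}"
    using special_rank_lab label_special[OF assms] by auto
  show "\<not> special p \<Longrightarrow> label p \<in> {low + 1..low + 2 * M}"
    using label_not_special[OF assms] by (auto simp: A_def)
qed

lemma inj_label: "inj_on label positions"
proof (rule inj_onI)
  fix p q assume pq: "p \<in> positions" "q \<in> positions" "label p = label q"
  show "p = q"
  proof (cases "special p \<longleftrightarrow> special q")
    case False
    thus ?thesis using label_range pq by fastforce
  next
    case True
    show ?thesis
    proof (cases "special p")
      case sp: True
      hence "rank p = rank q" using label_special pq True by (auto simp: lab_inj)
      thus ?thesis using rank_inj pq True sp by auto
    next
      case nsp: False
      have "junction_index p = junction_index q \<and> (upper p \<longleftrightarrow> upper q)"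
        using label_not_special[of p] label_not_special[of q] pq True nsp
        by (auto simp: A_def split: if_splits)
      thus ?thesis using junction_index_inj pq True nsp by auto
    qed
  qed
qed

lemma bij_label: "bij_betw label positions {1..2 * M + 2 * g}"
proof -
  have sub: "label ` positions \<subseteq> {1..2 * M + 2 * g}"
  proof safe
    fix j i b assume p: "(j, i, b) \<in> positions"
    \<comment> \<open>Rounding may raise \<open>low\<close> to \<open>g + 1\<close>, which is at
      most \<open>2 * g\<close> only for positive \<open>g\<close>.\<close>
    hence "g \<ge> 1" by (auto simp: positions_def)
    hence "low \<le> 2 * g" using low_bounds by auto
    thus "label (j, i, b) \<in> {1..2 * M + 2 * g}"
      using label_range[OF p] by (cases "special (j, i, b)") auto
  qed
  have "card (label ` positions) = card {1..2 * M + 2 * g}"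
    using inj_label by (simp add: card_image card_positions)
  hence "label ` positions = {1..2 * M + 2 * g}" using sub by (simp add: card_subset_eq)
  thus ?thesis using inj_label by (simp add: bij_betw_def)
qed

section \<open>Sums of arcs, which will be the vertex sums on $Y$\<close>

definition arc_sum :: "nat \<Rightarrow> nat \<Rightarrow> nat" where
  "arc_sum j i = src_label j i + tgt_label j i"

text \<open>The two halves have consecutive junction indices and lie on the same side of half of
  \<open>csum\<close>, so their deviations add up.\<close>

lemma arc_sum_middle:
  assumes "j < g" "0 < i" "i < l j"
  shows "arc_sum j i = (if odd i then csum - 2 * (P j + i) else csum + 2 * (P j + i))"
  using assms P_step[of j] by (auto simp: arc_sum_def src_label_def tgt_label_def csum_def A_def)

lemma arc_sum_first: "j < g \<Longrightarrow> arc_sum j 0 = lab (odd_paths + 1 + U j) + (A + (P j + 1))"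
  using l_pos[of j] by (simp add: arc_sum_def src_label_0) (simp add: tgt_label_def)

lemma arc_sum_last:
  assumes "j < g"
  shows "arc_sum j (l j) = (if even (l j) then lab (odd_paths + 2 + U j) + (A + (P j + l j))
           else (odd_paths - D j) + (A + 1 - (P j + l j)))"
  using l_pos[OF assms] by (auto simp: arc_sum_def tgt_label_last src_label_def)

text \<open>Inner sums differ from the odd number \<open>csum\<close> by an even number. On first
  and last arcs, \<open>P j\<close> is balanced by \<open>U j\<close> or \<open>D j\<close>, which
  have the same parity.\<close>

lemma even_arc_sum:
  assumes "j < g" "i \<le> l j"
  shows "even (arc_sum j i) \<longleftrightarrow> i = 0 \<or> i = l j"
proof -
  have csum: "odd csum" by (simp add: csum_def)
  have A: "even A" using even_M even_low by (simp add: A_def)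
  have le: "2 * (P j + i) \<le> csum" "P j + l j \<le> A + 1" using P_step[OF assms(1)] assms by (auto simp: csum_def A_def)
  note PU = even_P_U[of j] and PD = even_P_D[of j]
  have e0: "even (arc_sum j 0)" using PU A even_odd_paths by (auto simp: arc_sum_first[OF assms(1)] even_lab)
  have "D j \<le> odd_paths" using D_mono[of j g] assms by (simp add: odd_paths_def)
  hence el: "even (arc_sum j (l j))" using PU PD A even_odd_paths le
    by (auto simp: arc_sum_last[OF assms(1)] even_lab)
  have em: "odd (arc_sum j i)" if "0 < i" "i < l j"
    using arc_sum_middle[OF assms(1) that] csum le by (auto)
  show ?thesis using e0 el em assms by (cases "i = 0"; cases "i = l j") auto
qed

text \<open>The last arcs of trails with odd \<open>l j\<close> join two small labels and stay below
  all other first and last arcs (\<open>lowhigh\<close>). Their sums decrease with \<open>j\<close>;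
  the other sums increase, as rank and junction index both grow.\<close>

lemma special_arc_sum_inj_aux:
  assumes "j < g" "j' < g" "i = 0 \<or> i = l j" "i' = 0 \<or> i' = l j'" "j < j' \<or> j = j' \<and> i < i'"
  shows "arc_sum j i \<noteq> arc_sum j' i'"
proof -
  have lp: "l j \<ge> 1" "l j' \<ge> 1" using l_pos assms by auto
  have PM: "P j + l j \<le> M" "P j' + l j' \<le> M" using P_step assms by auto
  have lowhigh: "u + (A + 1 - x) \<noteq> lab v + (A + y)" if "u \<le> odd_paths" "odd_paths < v" "1 \<le> x" "1 \<le> y" for u v x y
    using that odd_paths_le by (auto simp: lab_def)
  show ?thesis
  proof (cases "j = j'")
    case True
    hence i: "i = 0" "i' = l j" using assms by auto
    show ?thesis
    proof (cases "even (l j)")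
      case True
      thus ?thesis using i \<open>j = j'\<close> lp lab_mono[of "odd_paths + 1 + U j" "odd_paths + 2 + U j"]
        by (simp add: arc_sum_first arc_sum_last assms)
    next
      case False
      thus ?thesis using i \<open>j = j'\<close> lp lowhigh[of "odd_paths - D j" "odd_paths + 1 + U j" "P j + l j" "P j + 1"]
        by (simp add: arc_sum_first arc_sum_last assms)
    qed
  next
    case False
    hence jj: "j < j'" using assms by auto
    note P = P_less[OF jj] and U = U_less1[OF jj] U_less2[OF jj]
    note D = D_less1[OF jj]
    have od: "odd (l j') \<Longrightarrow> D j' + 1 \<le> odd_paths" using odd_l_D assms by auto
    \<comment> \<open>\<open>u\<close> is the rank of the end half of the arc, unless the arc is the
      last one of a trail with odd \<open>l j\<close>, and \<open>x\<close> is the junction index of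
      its other half.\<close>
    define u where "u = (if i = 0 then odd_paths + 1 + U j else odd_paths + 2 + U j)"
    define x where "x = (if i = 0 then P j + 1 else P j + l j)"
    define u' where "u' = (if i' = 0 then odd_paths + 1 + U j' else odd_paths + 2 + U j')"
    define x' where "x' = (if i' = 0 then P j' + 1 else P j' + l j')"
    have up: "arc_sum j i = lab u + (A + x)" if "i = 0 \<or> even (l j)"
      using that assms lp by (auto simp: u_def x_def arc_sum_first arc_sum_last)
    have up': "arc_sum j' i' = lab u' + (A + x')" if "i' = 0 \<or> even (l j')"
      using that assms lp by (auto simp: u'_def x'_def arc_sum_first arc_sum_last)
    have lo: "arc_sum j i = (odd_paths - D j) + (A + 1 - x)" if "\<not> (i = 0 \<or> even (l j))"
      using that assms lp by (auto simp: x_def arc_sum_last)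
    have lo': "arc_sum j' i' = (odd_paths - D j') + (A + 1 - x')" if "\<not> (i' = 0 \<or> even (l j'))"
      using that assms lp by (auto simp: x'_def arc_sum_last)
    have x: "1 \<le> x" "1 \<le> x'" "x < x'" using P lp by (auto simp: x_def x'_def)
    have odd_paths: "odd_paths < u" "odd_paths < u'" by (auto simp: u_def u'_def)
    consider "i = 0 \<or> even (l j)" "i' = 0 \<or> even (l j')"
      | "i = 0 \<or> even (l j)" "\<not> (i' = 0 \<or> even (l j'))"
      | "\<not> (i = 0 \<or> even (l j))" "i' = 0 \<or> even (l j')"
      | "\<not> (i = 0 \<or> even (l j))" "\<not> (i' = 0 \<or> even (l j'))" by blast
    thus ?thesis
    proof cases
      case 1
      have "u < u'" using 1 U by (auto simp: u_def u'_def)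
      thus ?thesis using up[OF 1(1)] up'[OF 1(2)] lab_mono[of u u'] x by simp
    next
      case 2
      show ?thesis using up[OF 2(1)] lo'[OF 2(2)] lowhigh[of "odd_paths - D j'" u x' x] x odd_paths by simp
    next
      case 3
      show ?thesis using lo[OF 3(1)] up'[OF 3(2)] lowhigh[of "odd_paths - D j" u' x x'] x odd_paths by simp
    next
      case 4
      have "x' \<le> M" using PM lp by (auto simp: x'_def)
      thus ?thesis using 4 lo[OF 4(1)] lo'[OF 4(2)] D od x by (auto simp: A_def)
    qed
  qed
qed

lemma arc_sum_inj:
  assumes "j < g" "j' < g" "i \<le> l j" "i' \<le> l j'" "arc_sum j i = arc_sum j' i'"
  shows "j = j' \<and> i = i'"
proof (cases "i = 0 \<or> i = l j")
  case True
  hence T: "i' = 0 \<or> i' = l j'" using even_arc_sum assms by metis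
  show ?thesis
    using special_arc_sum_inj_aux[OF assms(1,2) True T] special_arc_sum_inj_aux[OF assms(2,1) T True] assms(5)
    by (metis linorder_neqE_nat)
next
  case False
  hence T: "\<not> (i' = 0 \<or> i' = l j')" using even_arc_sum assms by metis
  have "P j + i = P j' + i'"
    using arc_sum_middle[of j i] arc_sum_middle[of j' i'] P_step[of j] P_step[of j'] assms False T
    by (auto simp: csum_def A_def split: if_splits)
  thus ?thesis using index_inj[of j j' i i'] assms False T by auto
qed

section \<open>Separating the sums on $X$ from those on $Y$\<close>

lemma positive_middle:
  assumes "K = 1" "j < g" "2 \<le> i" "i < l j"
  shows "low < 2 * (P j + i)"
proof -
  have "P j + 3 * (g - j) \<le> P g"
  proof -
    have "P g = P j + (\<Sum>i\<in>{j..<g}. l i)"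
      using assms(2) unfolding P_def
      by (metis atLeast0LessThan less_imp_le_nat sum.atLeastLessThan_concat zero_le)
    moreover have "(\<Sum>i\<in>{j..<g}. l i) \<ge> (\<Sum>i\<in>{j..<g}. 3)"
    proof (rule sum_mono)
      fix i' assume "i' \<in> {j..<g}"
      thus "3 \<le> l i'" using l_mono[of j i'] assms by auto
    qed
    ultimately show ?thesis by simp
  qed
  moreover have "j' \<le> j \<Longrightarrow> j' \<le> P j'" for j'
  proof (induction j')
    case (Suc j') thus ?case using l_pos[of j'] assms by (simp add: P_Suc)
  qed simp
  moreover have "P g = 2 * g" unfolding P_g M_def using assms(1) by simp
  ultimately show ?thesis using assms low_bounds by fastforce
qed

lemma special_sum_neq_arc_sum:
  assumes "p \<in> positions" "special p" "j < g" "i \<le> l j"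
  shows "K * csum + label p \<noteq> arc_sum j i"
proof -
  have g: "1 \<le> g" using assms by auto
  note b = low_bounds odd_paths_le M_ge
  have lp: "l j \<ge> 1" "P j + l j \<le> M" using l_pos P_step assms by auto
  note sp = label_range(1)[OF assms(1,2)]
  note Ur = U_rank[OF assms(3)]
  \<comment> \<open>For \<open>K = 1\<close> the sums on $X$ exceed \<open>csum\<close> by a label
    that is at most \<open>low\<close> or greater than \<open>low + 2 * M\<close>; first and last
    arcs stay below, between or beside these ranges as stated here. The upper bound adds the largest
    label to \<open>A + M\<close>.\<close>
  have ends: "arc_sum j i < csum \<or> arc_sum j i \<in> {csum + low + 1..4 * M + 2 * g + low}" if ii: "i = 0 \<or> i = l j"
  proof -
    have up: "z + (A + x) < csum \<or> z + (A + x) \<in> {csum + low + 1..4 * M + 2 * g + low}"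
      if "z \<in> {1..low} \<union> {low + 2 * M + 1..2 * M + 2 * g}" "1 \<le> x" "x \<le> M" for z x
      using that b g by (auto simp: csum_def A_def)
    consider "i = 0" | "i = l j" "even (l j)" | "i = l j" "odd (l j)" using ii by blast
    thus ?thesis
    proof cases
      case 1
      thus ?thesis using up[OF special_rank_lab, of "odd_paths + 1 + U j" "P j + 1"] Ur lp
        by (simp add: arc_sum_first assms)
    next
      case 2
      thus ?thesis using up[OF special_rank_lab, of "odd_paths + 2 + U j" "P j + l j"] Ur lp
        by (simp add: arc_sum_last assms)
    next
      case 3
      thus ?thesis using b lp by (simp add: arc_sum_last assms csum_def A_def) linarith
    qed
  qed
  show ?thesis
  proof (cases "K = 1")
    case True
    hence Kc: "K * csum = csum" by simp
    show ?thesis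
    proof (cases "i = 0 \<or> i = l j")
      case T: True
      have "4 * M + 2 * g + low < csum + (low + 2 * M + 1)" using b by (simp add: csum_def A_def)
      thus ?thesis using ends[OF T] sp unfolding Kc by auto
    next
      case F: False
      hence i: "0 < i" "i < l j" using assms by auto
      show ?thesis
      proof (cases "odd i")
        case True
        thus ?thesis using arc_sum_middle[OF assms(3) i] sp Kc by auto
      next
        case False
        hence "2 \<le> i" using i(1) by presburger
        thus ?thesis using arc_sum_middle[OF assms(3) i] positive_middle[OF True assms(3) _ i(2)] sp lp i False
          unfolding Kc by auto
      qed
    qed
  next
    case False
    \<comment> \<open>For larger \<open>K\<close> the junctions alone contribute at least as much as
      any arc sum.\<close>
    hence "2 * csum \<le> K * csum" using K_pos by auto
    moreover have "arc_sum j i \<le> 2 * csum"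
    proof (cases "i = 0 \<or> i = l j")
      case True thus ?thesis using ends[OF True] b by (auto simp: csum_def A_def)
    next
      case F: False
      hence i: "0 < i" "i < l j" using assms by auto
      thus ?thesis using arc_sum_middle[OF assms(3) i] lp by (auto simp: csum_def A_def)
    qed
    moreover have "1 \<le> label p" using sp by auto
    ultimately show ?thesis by linarith
  qed
qed

end

subsection \<open>Vertex sums\<close>

lemma distinct_concat_nth_inj:
  assumes "distinct (concat xss)" "j < length xss" "j' < length xss"
    and "i < length (xss ! j)" "i' < length (xss ! j')" "xss ! j ! i = xss ! j' ! i'"
  shows "j = j' \<and> i = i'"
  using assms
proof (induction xss arbitrary: j j')
  case (Cons xs xss)
  have mem: "xss ! k ! m \<in> set (concat xss)" if "k < length xss" "m < length (xss ! k)" for k m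
    using that nth_mem[of k xss] nth_mem[of m "xss ! k"] unfolding set_concat by blast
  have disj: "set xs \<inter> set (concat xss) = {}" using Cons.prems(1) by simp
  show ?case
  proof (cases j; cases j')
    assume "j = 0" "j' = 0"
    thus ?thesis using Cons.prems by (simp add: nth_eq_iff_index_eq)
  next
    fix k assume k: "j = 0" "j' = Suc k"
    have "xs ! i \<in> set xs" using Cons.prems(4) k by simp
    moreover have "xss ! k ! i' \<in> set (concat xss)" using Cons.prems(3,5) k mem by simp
    moreover have "xs ! i = xss ! k ! i'" using Cons.prems(6) k by simp
    ultimately show ?thesis using disj by auto
  next
    fix k assume k: "j = Suc k" "j' = 0"
    have "xs ! i' \<in> set xs" using Cons.prems(5) k by simp
    moreover have "xss ! k ! i \<in> set (concat xss)" using Cons.prems(2,4) k mem by simp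
    moreover have "xss ! k ! i = xs ! i'" using Cons.prems(6) k by simp
    ultimately show ?thesis using disj by auto
  next
    fix k k' assume "j = Suc k" "j' = Suc k'"
    thus ?thesis using Cons.IH[of k k'] Cons.prems by auto
  qed
qed simp

lemma vertex_sum_eq:
  assumes "\<And>e. e \<in> E \<Longrightarrow> card e = 2"
  shows "vertex_sum E f u = (\<Sum>e | e \<in> E \<and> u \<in> e. f e)"
  unfolding vertex_sum_def
proof (rule sym, rule sum.reindex_cong[of "\<lambda>v. {u, v}"])
  show "inj_on (\<lambda>v. {u, v}) {v. {u, v} \<in> E}" by (auto simp: inj_on_def doubleton_eq_iff)
  show "{e. e \<in> E \<and> u \<in> e} = (\<lambda>v. {u, v}) ` {v. {u, v} \<in> E}"
    using assms by (force simp: card_2_iff insert_commute)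
qed simp

text \<open>The abstract labels are carried over to \<open>E\<close>: an edge \<open>{x, y}\<close>
  is the half at \<open>x\<close> of the arc with middle \<open>y\<close>.\<close>

locale decomposed_graph =
  incidence X Y "\<lambda>x y. {x, y} \<in> E" + path_labelling l g K
  for X Y :: "'a set" and E :: "'a set set" and l :: "nat \<Rightarrow> nat" and g K :: nat +
  fixes ts :: "('a, 'a) arc list list"
  assumes disj: "X \<inter> Y = {}"
    and edges: "e \<in> E \<Longrightarrow> \<exists>x\<in>X. \<exists>y\<in>Y. e = {x, y}"
    and degree: "x \<in> X \<Longrightarrow> card {e \<in> E. x \<in> e} = 2 * K + 1"
    and number_of_trails: "length ts = g"
    and length_trail: "j < g \<Longrightarrow> length (ts ! j) = l j + 1"
    and trails: "t \<in> set ts \<Longrightarrow> trail t"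
    and distinct_mids: "distinct (map mid (concat ts))"
    and set_mids: "set (map mid (concat ts)) = Y"
    and one_end: "x \<in> X \<Longrightarrow> (\<Sum>t\<leftarrow>ts. end_count x t) = 1"
begin

text \<open>The position \<open>(j, i, b)\<close> is the source half (or, if \<open>b\<close>, the target half) of arc $i$ of trail $j$.\<close>

definition arc_at :: "nat \<times> nat \<times> bool \<Rightarrow> ('a, 'a) arc" where
  "arc_at = (\<lambda>(j, i, b). ts ! j ! i)"
definition vert :: "nat \<times> nat \<times> bool \<Rightarrow> 'a" where
  "vert p = (if snd (snd p) then tgt (arc_at p) else src (arc_at p))"
definition edge :: "nat \<times> nat \<times> bool \<Rightarrow> 'a set" where
  "edge p = {vert p, mid (arc_at p)}"

lemma nth_trail: "j < g \<Longrightarrow> ts ! j \<in> set ts"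
  using number_of_trails by simp

lemma nth_nonempty: "j < g \<Longrightarrow> ts ! j \<noteq> []"
  using length_trail by fastforce

lemma positions_iff: "(j, i, b) \<in> positions \<longleftrightarrow> j < g \<and> i \<le> l j"
  by (simp add: positions_def)

lemma arc_at_set: "p \<in> positions \<Longrightarrow> arc_at p \<in> set (concat ts)"
  by (cases p) (auto simp: arc_at_def positions_iff length_trail number_of_trails intro!: bexI[of _ "ts ! fst p"])

lemma arc_at_arc: "p \<in> positions \<Longrightarrow> arc (arc_at p)"
  using arc_at_set trails by (fastforce simp: trail_def)

lemma arc_ends:
  assumes "arc a" "x \<in> X"
  shows "{x, mid a} \<in> E \<longleftrightarrow> x = src a \<or> x = tgt a"
  using assms unfolding arc_def by blast

lemma arc_XY: "arc a \<Longrightarrow> src a \<in> X \<and> tgt a \<in> X \<and> mid a \<in> Y \<and> {src a, mid a} \<in> E \<and> {tgt a, mid a} \<in> E"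
  unfolding arc_def by blast

lemma vert_X: "p \<in> positions \<Longrightarrow> vert p \<in> X"
  using arc_XY[OF arc_at_arc] by (simp add: vert_def)

lemma mid_Y: "p \<in> positions \<Longrightarrow> mid (arc_at p) \<in> Y"
  using arc_XY[OF arc_at_arc] by simp

lemma mid_inj:
  assumes "(j, i, b) \<in> positions" "(j', i', b') \<in> positions"
    and "mid (arc_at (j, i, b)) = mid (arc_at (j', i', b'))"
  shows "j = j' \<and> i = i'"
proof -
  have "distinct (concat (map (map mid) ts))" using distinct_mids by (simp add: map_concat)
  from distinct_concat_nth_inj[OF this, of j j' i i'] show ?thesis
    using assms by (simp add: positions_iff arc_at_def number_of_trails length_trail)
qed

text \<open>As $X$ and $Y$ are disjoint, the edge determines its end in $Y$, hence the arc, and its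
  end in $X$, hence the half of the arc.\<close>

lemma edge_inj: "inj_on edge positions"
proof (rule inj_onI)
  fix p q assume pq: "p \<in> positions" "q \<in> positions" "edge p = edge q"
  have m: "mid (arc_at p) = mid (arc_at q)" and v: "vert p = vert q"
    using pq vert_X[of p] vert_X[of q] mid_Y[of p] mid_Y[of q] disj by (auto simp: edge_def doubleton_eq_iff)
  obtain j i b j' i' b' where eq: "p = (j, i, b)" "q = (j', i', b')" by (cases p, cases q)
  hence ji: "j = j'" "i = i'" using mid_inj pq m by auto
  have "src (arc_at p) \<noteq> tgt (arc_at p)" using arc_at_arc[OF pq(1)] by (simp add: arc_def)
  thus "p = q" using v eq ji by (auto simp: vert_def arc_at_def split: if_splits)
qed

lemma arc_position:
  assumes "y \<in> Y"
  obtains j i where "j < g" "i \<le> l j" "mid (ts ! j ! i) = y"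
proof -
  obtain t a where ta: "t \<in> set ts" "a \<in> set t" "mid a = y" using assms set_mids by fastforce
  then obtain j i where "j < g" "t = ts ! j" "i < length (ts ! j)" "a = ts ! j ! i"
    unfolding in_set_conv_nth number_of_trails by blast
  thus ?thesis using that[of j i] ta length_trail[of j] by simp
qed

lemma edge_image: "edge ` positions = E"
proof
  show "edge ` positions \<subseteq> E" using arc_XY[OF arc_at_arc] by (auto simp: edge_def vert_def)
  show "E \<subseteq> edge ` positions"
  proof
    fix e assume "e \<in> E"
    then obtain x y where e: "x \<in> X" "y \<in> Y" "e = {x, y}" using edges by blast
    obtain j i where ji: "j < g" "i \<le> l j" "mid (ts ! j ! i) = y"
      using arc_position[OF e(2)] .
    have "(j, i, b) \<in> positions" for b using ji by (simp add: positions_iff)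
    moreover have "arc (ts ! j ! i)" using arc_at_arc[of "(j, i, True)"] calculation by (simp add: arc_at_def)
    hence "x = src (ts ! j ! i) \<or> x = tgt (ts ! j ! i)"
      using arc_ends e ji \<open>e \<in> E\<close> by blast
    hence "e = edge (j, i, x = tgt (ts ! j ! i))"
      using e ji by (auto simp: edge_def vert_def arc_at_def)
    ultimately show "e \<in> edge ` positions" by blast
  qed
qed

lemma bij_edge: "bij_betw edge positions E"
  using edge_inj edge_image by (simp add: bij_betw_def)

definition edge_label :: "'a set \<Rightarrow> nat" where
  "edge_label e = label (inv_into positions edge e)"

lemma edge_label_edge: "p \<in> positions \<Longrightarrow> edge_label (edge p) = label p"
  by (simp add: edge_label_def edge_inj)

lemma card_E: "card E = 2 * M + 2 * g"
  using bij_betw_same_card[OF bij_edge] card_positions by simp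

lemma bij_edge_label: "bij_betw edge_label E {1..card E}"
proof -
  have "bij_betw (label \<circ> inv_into positions edge) E {1..card E}"
    using bij_betw_trans[OF bij_betw_inv_into[OF bij_edge] bij_label] by (simp add: card_E)
  thus ?thesis by (simp add: edge_label_def[abs_def] comp_def)
qed

lemma card_edge: "e \<in> E \<Longrightarrow> card e = 2"
  using edges disj by (fastforce simp: card_2_iff)

lemma sum_incident:
  "(\<Sum>e | e \<in> E \<and> u \<in> e. f e) = (\<Sum>p | p \<in> positions \<and> u \<in> edge p. f (edge p))"
proof (rule sum.reindex_cong[of edge])
  show "inj_on edge {p. p \<in> positions \<and> u \<in> edge p}" using edge_inj by (auto simp: inj_on_def)
  show "{e. e \<in> E \<and> u \<in> e} = edge ` {p. p \<in> positions \<and> u \<in> edge p}"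
    unfolding edge_image[symmetric] by auto
qed simp

lemma vertex_sum_positions:
  "vertex_sum E edge_label u = (\<Sum>p | p \<in> positions \<and> u \<in> edge p. label p)"
  by (simp add: vertex_sum_eq[OF card_edge] sum_incident edge_label_edge)

lemma vertex_sum_Y:
  assumes "j < g" "i \<le> l j"
  shows "vertex_sum E edge_label (mid (ts ! j ! i)) = arc_sum j i"
proof -
  have pos: "(j, i, b) \<in> positions" for b using assms by (simp add: positions_iff)
  have "p = (j, i, False) \<or> p = (j, i, True)" if "p \<in> positions" "mid (ts ! j ! i) \<in> edge p" for p
  proof -
    have "mid (arc_at p) = mid (arc_at (j, i, True))"
      using that vert_X[OF that(1)] mid_Y[OF pos[of True]] disj by (auto simp: edge_def arc_at_def)
    thus ?thesis using mid_inj[of "fst p" "fst (snd p)" "snd (snd p)" j i True] that pos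
      by (cases p) auto
  qed
  hence "{p. p \<in> positions \<and> mid (ts ! j ! i) \<in> edge p} = {(j, i, False), (j, i, True)}"
    using pos by (auto simp: edge_def arc_at_def)
  thus ?thesis by (simp add: vertex_sum_positions arc_sum_def label_def)
qed

text \<open>The pair \<open>(j, i)\<close> stands for the junction between arcs \<open>i\<close> and
  \<open>Suc i\<close>.\<close>

definition junctions :: "'a \<Rightarrow> (nat \<times> nat) set" where
  "junctions x = {(j, i). j < g \<and> i < l j \<and> tgt (ts ! j ! i) = x}"

lemma junction_match:
  assumes "j < g" "i < l j"
  shows "src (ts ! j ! Suc i) = tgt (ts ! j ! i)"
  using trails[OF nth_trail[OF assms(1)]] length_trail[OF assms(1)] assms
  by (auto simp: trail_def successively_conv_nth)

text \<open>Stated for arbitrary \<open>F\<close>, because it is applied to the constant 1 to count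
  the junctions at \<open>x\<close> and to \<open>label\<close> to find the vertex sum.\<close>

lemma sum_at_X:
  assumes "x \<in> X"
  shows "(\<Sum>p | p \<in> positions \<and> x \<in> edge p. F p) =
    (\<Sum>p | p \<in> positions \<and> special p \<and> vert p = x. F p) +
    (\<Sum>(j, i)\<in>junctions x. F (j, i, True) + F (j, Suc i, False))"
proof -
  define in_pos where "in_pos = (\<lambda>(j :: nat, i :: nat). (j, i, True))"
  define out_pos where "out_pos = (\<lambda>(j :: nat, i). (j, Suc i, False))"
  let ?S = "{p. p \<in> positions \<and> special p \<and> vert p = x}"
  have fin: "finite (junctions x)"
    by (rule finite_subset[of _ "Sigma {..<g} (\<lambda>j. {..<l j})"]) (auto simp: junctions_def)
  have finS: "finite ?S" using finite_positions by simp
  have x_edge: "x \<in> edge p \<longleftrightarrow> vert p = x" if "p \<in> positions" for p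
    using that assms mid_Y[OF that] disj by (auto simp: edge_def)
  have "{p. p \<in> positions \<and> x \<in> edge p} = ?S \<union> (in_pos ` junctions x \<union> out_pos ` junctions x)"
    (is "?A = ?S \<union> ?B")
  proof (intro equalityI subsetI)
    fix p assume "p \<in> ?A"
    hence p: "p \<in> positions" "vert p = x" using x_edge by blast+
    obtain j i b where eq: "p = (j, i, b)" by (cases p)
    have ji: "j < g" "i \<le> l j" using p eq by (auto simp: positions_def)
    show "p \<in> ?S \<union> ?B"
    proof (cases "special p")
      case False
      show ?thesis
      proof (cases b)
        case True
        hence "(j, i) \<in> junctions x" using p ji eq False
          by (auto simp: junctions_def special_def vert_def arc_at_def)
        thus ?thesis using eq True by (auto simp: in_pos_def)
      next
        case b: False
        then obtain i' where i': "i = Suc i'" using False eq by (cases i) (auto simp: special_def)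
        hence "(j, i') \<in> junctions x" using p ji eq b junction_match[of j i']
          by (auto simp: junctions_def vert_def arc_at_def)
        thus ?thesis using eq b i' by (force simp: out_pos_def)
      qed
    qed (use p in auto)
  next
    fix p assume "p \<in> ?S \<union> ?B"
    hence "p \<in> positions \<and> vert p = x"
      using junction_match
      by (auto simp: in_pos_def out_pos_def junctions_def positions_def vert_def arc_at_def)
    thus "p \<in> ?A" using x_edge by blast
  qed
  moreover have "?S \<inter> ?B = {}"
    by (auto simp: in_pos_def out_pos_def junctions_def special_def)
  moreover have "in_pos ` junctions x \<inter> out_pos ` junctions x = {}"
    by (auto simp: in_pos_def out_pos_def)
  moreover have "inj_on in_pos (junctions x)" "inj_on out_pos (junctions x)"
    by (auto simp: in_pos_def out_pos_def inj_on_def)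
  ultimately have "(\<Sum>p | p \<in> positions \<and> x \<in> edge p. F p) =
      (\<Sum>p\<in>?S. F p) + ((\<Sum>q\<in>junctions x. F (in_pos q)) + (\<Sum>q\<in>junctions x. F (out_pos q)))"
    using fin finS by (simp add: sum.union_disjoint sum.reindex)
  thus ?thesis by (simp add: in_pos_def out_pos_def case_prod_unfold sum.distrib)
qed

text \<open>The special positions correspond to pairs of a trail and one of its two ends, so those
  at \<open>x\<close> are counted by \<open>end_count\<close>.\<close>

lemma special_positions_at:
  assumes "x \<in> X"
  obtains p where "{p. p \<in> positions \<and> special p \<and> vert p = x} = {p}"
proof -
  define sp where "sp = (\<lambda>(j, b). (j, if b then l j else 0, b))"
  have img: "{p \<in> positions. special p} = sp ` ({..<g} \<times> UNIV)"
  proof (intro equalityI subsetI)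
    fix p assume "p \<in> {p \<in> positions. special p}"
    moreover obtain j i b where p: "p = (j, i, b)" by (cases p)
    ultimately have "j < g" "p = sp (j, b)"
      by (auto simp: sp_def positions_def special_def split: if_splits)
    thus "p \<in> sp ` ({..<g} \<times> UNIV)" by blast
  qed (auto simp: sp_def positions_def special_def)
  have inj: "inj_on sp ({..<g} \<times> UNIV)" by (auto simp: sp_def inj_on_def)
  have "card {p. p \<in> positions \<and> special p \<and> vert p = x} =
      (\<Sum>p\<in>{p \<in> positions. special p}. of_bool (vert p = x))"
    using finite_positions by (simp add: of_bool_def sum.If_cases Int_def conj_assoc)
  also have "\<dots> = (\<Sum>q\<in>{..<g} \<times> UNIV. of_bool (vert (sp q) = x))"
    by (simp only: img sum.reindex[OF inj] comp_def)
  also have "\<dots> = (\<Sum>j<g. \<Sum>b\<in>UNIV. of_bool (vert (sp (j, b)) = x))"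
    by (subst sum.cartesian_product) (simp add: case_prod_unfold)
  also have "\<dots> = (\<Sum>j<g. end_count x (ts ! j))"
  proof (rule sum.cong)
    fix j assume "j \<in> {..<g}"
    hence "ts ! j \<noteq> []" "length (ts ! j) = l j + 1" using nth_nonempty length_trail by auto
    thus "(\<Sum>b\<in>UNIV. of_bool (vert (sp (j, b)) = x)) = end_count x (ts ! j)"
      by (simp add: UNIV_bool sp_def vert_def arc_at_def end_count_def hd_conv_nth last_conv_nth)
  qed simp
  also have "\<dots> = 1" using one_end[OF assms] by (simp add: sum_list_sum_nth atLeast0LessThan number_of_trails)
  finally show ?thesis by (rule card_1_singletonE) (rule that)
qed

lemma card_junctions:
  assumes "x \<in> X"
  shows "card (junctions x) = K"
proof -
  obtain p where p: "{p. p \<in> positions \<and> special p \<and> vert p = x} = {p}"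
    using special_positions_at[OF assms] .
  have "2 * K + 1 = (\<Sum>e | e \<in> E \<and> x \<in> e. 1)" using degree[OF assms] by simp
  also have "\<dots> = 1 + 2 * card (junctions x)"
    unfolding sum_incident sum_at_X[OF assms] p by simp
  finally show ?thesis by simp
qed

lemma vertex_sum_X:
  assumes "x \<in> X"
  obtains p where "p \<in> positions" "special p" "vert p = x" "vertex_sum E edge_label x = K * csum + label p"
proof -
  obtain p where p: "{p. p \<in> positions \<and> special p \<and> vert p = x} = {p}"
    using special_positions_at[OF assms] .
  have "(\<Sum>(j, i)\<in>junctions x. label (j, i, True) + label (j, Suc i, False)) = (\<Sum>q\<in>junctions x. csum)"
    using junction_sum by (intro sum.cong) (auto simp: junctions_def label_def)
  hence "vertex_sum E edge_label x = label p + K * csum"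
    unfolding vertex_sum_positions sum_at_X[OF assms] p by (simp add: card_junctions[OF assms])
  thus ?thesis using that[of p] p by auto
qed

lemma antimagic_graph: "antimagic (X \<union> Y) E"
proof -
  \<comment> \<open>The common part \<open>K * csum\<close> cancels, and an end label determines its
    half-edge and thereby the vertex.\<close>
  have X_inj: "x = x'" if "x \<in> X" "x' \<in> X" "vertex_sum E edge_label x = vertex_sum E edge_label x'" for x x'
    using vertex_sum_X[OF that(1)] vertex_sum_X[OF that(2)] that(3) inj_label
    by (metis add_left_cancel inj_onD)
  have Y_inj: "y = y'" if y: "y \<in> Y" "y' \<in> Y" and eq: "vertex_sum E edge_label y = vertex_sum E edge_label y'" for y y'
  proof -
    obtain j i where ji: "j < g" "i \<le> l j" "mid (ts ! j ! i) = y"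
      using arc_position[OF y(1)] .
    obtain j' i' where ji': "j' < g" "i' \<le> l j'" "mid (ts ! j' ! i') = y'"
      using arc_position[OF y(2)] .
    show ?thesis using arc_sum_inj[of j j' i i'] vertex_sum_Y[of j i] vertex_sum_Y[of j' i'] ji ji' eq by simp
  qed
  have XY: "vertex_sum E edge_label x \<noteq> vertex_sum E edge_label y" if xy: "x \<in> X" "y \<in> Y" for x y
  proof -
    obtain p where p: "p \<in> positions" "special p" "vertex_sum E edge_label x = K * csum + label p"
      using vertex_sum_X[OF xy(1)] by blast
    obtain j i where ji: "j < g" "i \<le> l j" "mid (ts ! j ! i) = y"
      using arc_position[OF xy(2)] .
    show ?thesis using special_sum_neq_arc_sum[OF p(1,2), of j i] vertex_sum_Y[of j i] p ji by simp
  qed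
  have "inj_on (vertex_sum E edge_label) (X \<union> Y)"
  proof (rule inj_onI)
    fix u v assume "u \<in> X \<union> Y" "v \<in> X \<union> Y" "vertex_sum E edge_label u = vertex_sum E edge_label v"
    thus "u = v" using X_inj[of u v] Y_inj[of u v] XY[of u v] XY[of v u] by auto
  qed
  thus ?thesis using bij_edge_label unfolding antimagic_def antimagic_labelling_def by blast
qed

end

theorem theorem1:
  fixes k :: nat and X Y :: "'a set" and E :: "'a set set"
  assumes "3 \<le> k" and "odd k"
    and "biregular_bipartite_graph k 2 X Y E"
    and "connected_graph (X \<union> Y) E"
  shows "antimagic (X \<union> Y) E"
proof -
  define K where "K = (k - 1) div 2"
  have K: "k = 2 * K + 1" "1 \<le> K" using assms(1,2) by (auto simp: K_def elim!: oddE)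
  have fin: "finite X" "finite Y" and disj: "X \<inter> Y = {}"
    and edges: "\<And>e. e \<in> E \<Longrightarrow> \<exists>x\<in>X. \<exists>y\<in>Y. e = {x, y}"
    and degX: "\<And>x. x \<in> X \<Longrightarrow> card {e \<in> E. x \<in> e} = k"
    and degY: "\<And>y. y \<in> Y \<Longrightarrow> card {e \<in> E. y \<in> e} = 2"
    using assms(3)
    by (auto simp: biregular_bipartite_graph_def bipartite_graph_def simple_graph_def graph_degree_def)
  have edge_ends: "x \<in> X \<and> y \<in> Y" if "{x, y} \<in> E" "x \<in> X \<or> y \<in> Y" for x y
    using edges[OF that(1)] that(2) disj by (auto simp: doubleton_eq_iff)
  have nX: "card {y \<in> Y. {x, y} \<in> E} = k" if "x \<in> X" for x
  proof -
    have "{e \<in> E. x \<in> e} = (\<lambda>y. {x, y}) ` {y \<in> Y. {x, y} \<in> E}"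
      using edges edge_ends that disj by (fastforce simp: image_iff)
    moreover have "inj_on (\<lambda>y. {x, y}) {y \<in> Y. {x, y} \<in> E}" by (auto simp: inj_on_def doubleton_eq_iff)
    ultimately show ?thesis using degX[OF that] by (simp add: card_image)
  qed
  have nY: "card {x \<in> X. {x, y} \<in> E} = 2" if "y \<in> Y" for y
  proof -
    have "{e \<in> E. y \<in> e} = (\<lambda>x. {x, y}) ` {x \<in> X. {x, y} \<in> E}"
      using edges edge_ends that disj by (fastforce simp: image_iff)
    moreover have "inj_on (\<lambda>x. {x, y}) {x \<in> X. {x, y} \<in> E}" by (auto simp: inj_on_def doubleton_eq_iff)
    ultimately show ?thesis using degY[OF that] by (simp add: card_image)
  qed
  interpret incidence X Y "\<lambda>x y. {x, y} \<in> E"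
  proof
    fix y assume "y \<in> Y"
    thus "\<exists>u v. u \<noteq> v \<and> {x \<in> X. {x, y} \<in> E} = {u, v}" using nY[of y] by (auto simp: card_2_iff)
  qed (use fin in auto)
  have "\<And>x. x \<in> X \<Longrightarrow> odd (card {y \<in> Y. {x, y} \<in> E})"
    "\<And>x. x \<in> X \<Longrightarrow> 2 \<le> card {y \<in> Y. {x, y} \<in> E}"
    using nX assms(1,2) by auto
  then obtain ts where ts: "\<forall>t\<in>set ts. trail t \<and> 2 \<le> length t"
    "distinct (map mid (concat ts))" "set (map mid (concat ts)) = Y"
    "\<forall>x\<in>X. (\<Sum>t\<leftarrow>ts. end_count x t) = 1" "sorted (map length ts)"
    using trail_decomposition by blast
  \<comment> \<open>Counting the ends of trails by vertices and by trails gives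
    \<open>card X = 2 * length ts\<close>.\<close>
  have "card X = (\<Sum>x\<in>X. \<Sum>t\<leftarrow>ts. end_count x t)" using ts(4) by simp
  also have "\<dots> = (\<Sum>x\<in>X. \<Sum>j<length ts. end_count x (ts ! j))"
    by (simp add: sum_list_sum_nth atLeast0LessThan)
  also have "\<dots> = (\<Sum>j<length ts. \<Sum>x\<in>X. end_count x (ts ! j))" by (rule sum.swap)
  also have "\<dots> = (\<Sum>j<length ts. 2)"
  proof (rule sum.cong)
    fix j assume "j \<in> {..<length ts}"
    hence "trail (ts ! j)" using ts(1) by simp
    hence "src (hd (ts ! j)) \<in> X" "tgt (last (ts ! j)) \<in> X" by (auto simp: trail_def arc_def)
    thus "(\<Sum>x\<in>X. end_count x (ts ! j)) = 2" using fin by (simp add: end_count_def sum.distrib of_bool_def)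
  qed simp
  finally have cX: "card X = 2 * length ts" by simp
  have "k * card X = (\<Sum>x\<in>X. card {y \<in> Y. {x, y} \<in> E})" using nX by simp
  also have "\<dots> = 2 * card Y" using sum_multicount[OF fin, of "\<lambda>x y. {x, y} \<in> E" 2] nY by simp
  finally have cY: "card Y = k * length ts" using cX by simp
  \<comment> \<open>Each trail has one junction fewer than arcs, so with $g$ trails and $kg$ arcs
    there are $kg - g = 2Kg$ junctions.\<close>
  have "card Y = length (concat ts)" using ts(2,3) distinct_card by (metis length_map)
  also have "\<dots> = (\<Sum>j<length ts. length (ts ! j))"
    by (simp add: length_concat sum_list_sum_nth atLeast0LessThan)
  also have "\<dots> = (\<Sum>j<length ts. (length (ts ! j) - 1) + 1)"
    using ts(1) by (intro sum.cong) (auto dest!: nth_mem)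
  also have "\<dots> = (\<Sum>j<length ts. length (ts ! j) - 1) + length ts"
    unfolding sum.distrib by simp
  finally have sum: "(\<Sum>j<length ts. length (ts ! j) - 1) = 2 * K * length ts"
    using cY K by simp
  interpret decomposed_graph X Y E "\<lambda>j. length (ts ! j) - 1" "length ts" K ts
  proof
    show "1 \<le> length (ts ! j) - 1" if "j < length ts" for j using bspec[OF ts(1) nth_mem[OF that]] by linarith
    thus "length (ts ! j) = length (ts ! j) - 1 + 1" if "j < length ts" for j
      using that by fastforce
    show "length (ts ! i) - 1 \<le> length (ts ! j) - 1" if "i \<le> j" "j < length ts" for i j
      using sorted_nth_mono[OF ts(5), of i j] that by simp
  qed (use ts(1-4) disj edges degX K sum in \<open>auto simp del: set_concat\<close>)
  show ?thesis by (rule antimagic_graph)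
qed

end
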